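(* Let $\Omega\subseteq\mathbb{R}^2$ be a simply connected domain with Jordan boundary, let $w$ be a weight function on $\Omega$ which vanishes along $\partial\Omega$, let $\{p_{n,k}\}_{n\in\mathbb{Z}_+,\,k=0,\ldots,n}$ be an orthonormal polynomial system in $\Omega$ with respect to $w$, and let $\varphi_{n,k}=\sqrt{w}\,p_{n,k}$. Then the differentiation matrices $\mathcal{X}$ and $\mathcal{Y}$ with entries $$\mathcal{X}_{(m,\ell),(n,k)}=\int_\Omega \frac{\partial\varphi_{n,k}}{\partial x}\,\varphi_{m,\ell}\,dx\,dy,\qquad \mathcal{Y}_{(m,\ell),(n,k)}=\int_\Omega \frac{\partial\varphi_{n,k}}{\partial y}\,\varphi_{m,\ell}\,dx\,dy$$ ($m,n\in\mathbb{Z}_+$, $\ell=0,\ldots,m$, $k=0,\ldots,n$) are skew-symmetric.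
   Context: $\mathbb{Z}_+=\{0,1,2,\ldots\}$. A domain with Jordan boundary is a domain whose boundary $\partial\Omega$ is a Jordan curve. A weight function $w$ on $\Omega$ is a function, nonnegative in $\Omega$, with an infinite number of points of increase and such that $\int_\Omega w\,dx\,dy>0$. That $w$ vanishes along $\partial\Omega$ means $w(x,y)=0$ for all $(x,y)\in\partial\Omega$. An orthonormal polynomial system in $\Omega$ with respect to $w$ is a family $\{p_{n,k}\}_{n\in\mathbb{Z}_+,\,k=0,\ldots,n}$ where each $p_{n,k}$ is a (real) bivariate polynomial of total degree $n$ and $\int_\Omega p_{m,\ell}\,p_{n,k}\,w\,dx\,dy=\delta_{m,n}\delta_{\ell,k}$ for all $m,n\in\mathbb{Z}_+$, $\ell=0,\ldots,m$, $k=0,\ldots,n$. The functions $\varphi_{n,k}(x,y)=\sqrt{w(x,y)}\,p_{n,k}(x,y)$ form the associated W-system, which is orthonormal in $\mathrm{L}_2(\Omega)$. Skew-symmetry of $\mathcal{X}$ means $\mathcal{X}_{(m,\ell),(n,k)}=-\mathcal{X}_{(n,k),(m,\ell)}$ for all admissible indices, and likewise for $\mathcal{Y}$.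
   Formalization: Added: w is continuous on the closure of Ω (w = 1 inside and 0 on ∂Ω is a counterexample otherwise), the partial derivatives of each φ_{n,k} exist at every point of Ω where w > 0, and the integrals defining the entries converge absolutely. *)

theory Defs
  imports "HOL-Analysis.Analysis" "HOL-Computational_Algebra.Polynomial"
begin

definition domain_with_jordan_boundary :: "(real \<times> real) set \<Rightarrow> bool" where
  "domain_with_jordan_boundary \<Omega> \<longleftrightarrow>
     open \<Omega> \<and> connected \<Omega> \<and> \<Omega> \<noteq> {} \<and>
     (\<exists>c. simple_path c \<and> pathfinish c = pathstart c \<and> path_image c = frontier \<Omega>)"

text \<open>
  In the plane, a point of increase of the weight is a point of the support of the
  measure \<open>w dx dy\<close> on \<open>\<Omega>\<close>: every neighbourhood of it has positive mass.
\<close>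

definition points_of_increase :: "(real \<times> real) set \<Rightarrow> (real \<times> real \<Rightarrow> real) \<Rightarrow> (real \<times> real) set" where
  "points_of_increase \<Omega> w = {z. \<forall>e>0. 0 < (LINT u:\<Omega> \<inter> ball z e|lborel. w u)}"

definition weight_function :: "(real \<times> real) set \<Rightarrow> (real \<times> real \<Rightarrow> real) \<Rightarrow> bool" where
  "weight_function \<Omega> w \<longleftrightarrow>
     (\<forall>z\<in>\<Omega>. 0 \<le> w z) \<and>
     infinite (points_of_increase \<Omega> w) \<and>
     set_integrable lborel \<Omega> w \<and>
     0 < (LINT z:\<Omega>|lborel. w z)"

text \<open>
  A real bivariate polynomial is represented as a polynomial in \<open>y\<close> whose coefficients are
  polynomials in \<open>x\<close>, so \<open>coeff (coeff P j) i\<close> is the coefficient of \<open>x^i y^j\<close>.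
  As for \<^const>\<open>degree\<close>, the zero polynomial has total degree 0.
\<close>

definition poly_xy :: "real poly poly \<Rightarrow> real \<times> real \<Rightarrow> real" where
  "poly_xy P z = poly (poly P [:snd z:]) (fst z)"

definition total_degree :: "real poly poly \<Rightarrow> nat" where
  "total_degree P = Max (insert 0 {i + j | i j. coeff (coeff P j) i \<noteq> 0})"

definition graded_indices :: "(nat \<times> nat) set" where
  "graded_indices = {(n, k). k \<le> n}"

text \<open>
  Only the values \<open>p (n, k)\<close> with \<open>k \<le> n\<close> are constrained. Each \<open>p\<^sup>2 w\<close> is integrable because its
  Bochner integral is nonzero; the mixed products are then integrable as well.
\<close>

definition orthonormal_polynomial_system ::
    "(real \<times> real) set \<Rightarrow> (real \<times> real \<Rightarrow> real) \<Rightarrow> (nat \<times> nat \<Rightarrow> real poly poly) \<Rightarrow> bool" where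
  "orthonormal_polynomial_system \<Omega> w p \<longleftrightarrow>
     (\<forall>(n, k)\<in>graded_indices. total_degree (p (n, k)) = n) \<and>
     (\<forall>a\<in>graded_indices. \<forall>b\<in>graded_indices.
        (LINT z:\<Omega>|lborel. poly_xy (p a) z * poly_xy (p b) z * w z) = (if a = b then 1 else 0))"

definition W_system ::
    "(real \<times> real \<Rightarrow> real) \<Rightarrow> (nat \<times> nat \<Rightarrow> real poly poly) \<Rightarrow> nat \<times> nat \<Rightarrow> real \<times> real \<Rightarrow> real" where
  "W_system w p a z = sqrt (w z) * poly_xy (p a) z"

definition partial_x :: "(real \<times> real \<Rightarrow> real) \<Rightarrow> real \<times> real \<Rightarrow> real" where
  "partial_x f z = deriv (\<lambda>t. f (t, snd z)) (fst z)"

definition partial_y :: "(real \<times> real \<Rightarrow> real) \<Rightarrow> real \<times> real \<Rightarrow> real" where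
  "partial_y f z = deriv (\<lambda>t. f (fst z, t)) (snd z)"

definition has_partials_at :: "(real \<times> real \<Rightarrow> real) \<Rightarrow> real \<times> real \<Rightarrow> bool" where
  "has_partials_at f z \<longleftrightarrow>
     (\<lambda>t. f (t, snd z)) field_differentiable (at (fst z)) \<and>
     (\<lambda>t. f (fst z, t)) field_differentiable (at (snd z))"

text \<open>
  In the matrices below the second index belongs to the differentiated function. The integrals
  are Lebesgue integrals, with value 0 if the integrand is not integrable, so the matrices
  are meaningful only under the accompanying existence predicate. For a W-system, differentiability
  matters only where \<open>w > 0\<close>: where \<open>w = 0\<close> the factor \<open>\<phi> a\<close> vanishes, and the integrand is 0
  whatever value \<^const>\<open>deriv\<close> takes.
\<close>

definition diff_matrix_x ::
    "(real \<times> real) set \<Rightarrow> (nat \<times> nat \<Rightarrow> real \<times> real \<Rightarrow> real) \<Rightarrow> nat \<times> nat \<Rightarrow> nat \<times> nat \<Rightarrow> real" where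
  "diff_matrix_x \<Omega> \<phi> a b = (LINT z:\<Omega>|lborel. partial_x (\<phi> b) z * \<phi> a z)"

definition diff_matrix_y ::
    "(real \<times> real) set \<Rightarrow> (nat \<times> nat \<Rightarrow> real \<times> real \<Rightarrow> real) \<Rightarrow> nat \<times> nat \<Rightarrow> nat \<times> nat \<Rightarrow> real" where
  "diff_matrix_y \<Omega> \<phi> a b = (LINT z:\<Omega>|lborel. partial_y (\<phi> b) z * \<phi> a z)"

definition diff_matrices_exist ::
    "(real \<times> real) set \<Rightarrow> (nat \<times> nat \<Rightarrow> real \<times> real \<Rightarrow> real) \<Rightarrow> bool" where
  "diff_matrices_exist \<Omega> \<phi> \<longleftrightarrow>
     (\<forall>a\<in>graded_indices. \<forall>b\<in>graded_indices.
        set_integrable lborel \<Omega> (\<lambda>z. partial_x (\<phi> b) z * \<phi> a z) \<and>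
        set_integrable lborel \<Omega> (\<lambda>z. partial_y (\<phi> b) z * \<phi> a z))"

definition skew_symmetric_on :: "'i set \<Rightarrow> ('i \<Rightarrow> 'i \<Rightarrow> real) \<Rightarrow> bool" where
  "skew_symmetric_on I A \<longleftrightarrow> (\<forall>a\<in>I. \<forall>b\<in>I. A a b = - A b a)"

end

theory Submission
  imports Defs
begin

text \<open>
  The product of two elements of the W-system is \<open>w p\<^sub>a p\<^sub>b\<close>. Extended by 0 outside \<open>\<Omega>\<close> it is a
  function \<open>F\<close> that is continuous on the plane, because \<open>w\<close> vanishes on the frontier, and integrable.
  The sum of an entry and its transposed entry is the integral over the plane of a partial derivative
  of \<open>F\<close>. By Fubini it suffices that on almost every line the derivative integrates to 0. On a line,
  \<open>F\<close> need not be differentiable at those zeros where \<open>w\<close> vanishes, so the fundamental theorem of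
  calculus is applied to \<open>h\<^sub>\<epsilon> \<circ> F\<close>, where \<open>h\<^sub>\<epsilon> = C1_threshold \<epsilon>\<close> is continuously differentiable, vanishes on
  \<open>[-\<epsilon>, \<epsilon>]\<close>, and has a derivative that is bounded by 1 and tends to 1 off 0. In the limit
  \<open>\<epsilon> \<rightarrow> 0\<close> only the zeros of \<open>F\<close> with nonzero derivative are lost, and these are countably many.
  Boundary terms at infinity vanish by integrability of \<open>F\<close>.
\<close>

section \<open>Isolated points and zeros with nonzero derivative\<close>

text \<open>Each point of \<open>S\<close> is cut out of \<open>S\<close> by a member of a countable
  base, and different points need different members.\<close>

lemma countable_if_no_limit_point:
  fixes S :: "'a::second_countable_topology set"
  assumes "\<And>x. x \<in> S \<Longrightarrow> \<not> x islimpt S"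
  shows "countable S"
proof -
  obtain B :: "'a set set" where B: "countable B" "topological_basis B"
    using ex_countable_basis by blast
  have "\<exists>U. U \<in> B \<and> U \<inter> S = {x}" if x: "x \<in> S" for x
  proof -
    obtain T where T: "open T" "x \<in> T" "\<forall>y\<in>S. y \<in> T \<longrightarrow> y = x"
      using assms[OF x] unfolding islimpt_def by blast
    then obtain U where "U \<in> B" "x \<in> U" "U \<subseteq> T"
      using topological_basisE[OF B(2)] by metis
    then show ?thesis
      using T x by blast
  qed
  then obtain f where f: "\<And>x. x \<in> S \<Longrightarrow> f x \<in> B \<and> f x \<inter> S = {x}"
    by metis
  have "inj_on f S"
    by (rule inj_onI) (metis f singleton_inject)
  moreover have "f ` S \<subseteq> B"
    using f by blast
  ultimately show ?thesis
    using B(1) countable_image_inj_on countable_subset by blast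
qed

text \<open>Near such a zero \<open>x\<close> the difference quotient \<open>f y / (y - x)\<close>
  stays close to \<open>g x\<close> and hence nonzero, so \<open>x\<close> is isolated among the
  zeros of \<open>f\<close>.\<close>

lemma countable_zeros_nonzero_deriv:
  fixes f g :: "real \<Rightarrow> real"
  shows "countable {x. f x = 0 \<and> (f has_real_derivative g x) (at x) \<and> g x \<noteq> 0}" (is "countable ?S")
proof (rule countable_if_no_limit_point)
  fix x assume x: "x \<in> ?S"
  then have "((\<lambda>y. (f y - f x) / (y - x)) \<longlongrightarrow> g x) (at x)" "g x \<noteq> 0"
    by (auto simp: has_field_derivative_iff)
  then have "eventually (\<lambda>y. (f y - f x) / (y - x) \<noteq> 0) (at x)"
    by (rule tendsto_imp_eventually_ne)
  then have "eventually (\<lambda>y. y \<notin> ?S) (at x)"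
    by eventually_elim (use x in auto)
  then show "\<not> x islimpt ?S"
    by (simp add: islimpt_iff_eventually)
qed

section \<open>Derivatives integrated over the whole line\<close>

text \<open>If \<open>L\<close> were nonzero, a multiple of \<open>f\<close> would dominate the
  indicator of a half-line, which has infinite measure.\<close>

lemma tendsto_at_top_integrable_imp_zero:
  fixes f :: "real \<Rightarrow> real"
  assumes f: "integrable lborel f" and lim: "(f \<longlongrightarrow> L) at_top"
  shows "L = 0"
proof (rule ccontr)
  assume "L \<noteq> 0"
  have "eventually (\<lambda>x. \<bar>L\<bar> / 2 < \<bar>f x\<bar>) at_top"
    by (rule order_tendstoD(1)[OF tendsto_rabs[OF lim]]) (use \<open>L \<noteq> 0\<close> in simp)
  then obtain R where R: "\<And>x. x \<ge> R \<Longrightarrow> \<bar>L\<bar> / 2 < \<bar>f x\<bar>"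
    by (auto simp: eventually_at_top_linorder)
  have "integrable lborel (indicator {R..} :: real \<Rightarrow> real)"
  proof (rule Bochner_Integration.integrable_bound)
    show "integrable lborel (\<lambda>x. 2 / \<bar>L\<bar> * f x)"
      using f by simp
    show "AE x in lborel. norm (indicator {R..} x :: real) \<le> norm (2 / \<bar>L\<bar> * f x)"
      using R \<open>L \<noteq> 0\<close> by (auto simp: indicator_def abs_mult field_simps less_imp_le)
  qed simp
  then have "emeasure lborel {R..} < \<infinity>"
    by (simp add: integrable_indicator_iff)
  then obtain r where r: "r \<ge> 0" "emeasure lborel {R..} = ennreal r"
    by (metis ennreal_cases infinity_ennreal_def less_irrefl)
  have "ennreal (r + 1) \<le> emeasure lborel {R..}"
    using emeasure_mono[of "{R..R + (r + 1)}" "{R..}" lborel] r(1) by simp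
  then show False
    using r by (simp add: ennreal_le_iff)
qed

text \<open>The integrals of \<open>g\<close> over \<open>{-y..y}\<close> equal
  \<open>f y - f (- y)\<close> and converge to the full integral; this limit must vanish because the
  difference is itself integrable in \<open>y\<close>.\<close>

lemma integral_deriv_eq_zero:
  fixes f g :: "real \<Rightarrow> real"
  assumes der: "\<And>x. (f has_real_derivative g x) (at x)"
    and f: "integrable lborel f" and g: "integrable lborel g"
  shows "integral\<^sup>L lborel g = 0"
proof -
  have eq: "(\<integral>x. indicator {-y..y} x *\<^sub>R g x \<partial>lborel) = f y - f (- y)" if "y \<ge> 0" for y
  proof -
    have "set_integrable lborel {-y..y} g"
      unfolding set_integrable_def by (rule integrable_mult_indicator) (use g in auto)
    then have "(LINT x:{-y..y}|lborel. g x) = integral {-y..y} g"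
      by (rule set_borel_integral_eq_integral)
    also have "(g has_integral (f y - f (- y))) {-y..y}"
      by (rule fundamental_theorem_of_calculus)
         (use that der in \<open>auto simp: has_real_derivative_iff_has_vector_derivative[symmetric]
            intro: DERIV_subset\<close>)
    then have "integral {-y..y} g = f y - f (- y)"
      by (rule integral_unique)
    finally show ?thesis
      by (simp add: set_lebesgue_integral_def)
  qed
  have "((\<lambda>y. \<integral>x. indicator {-y..y} x *\<^sub>R g x \<partial>lborel) \<longlongrightarrow> integral\<^sup>L lborel g) at_top"
  proof (rule integral_dominated_convergence_at_top)
    show "integrable lborel (\<lambda>x. norm (g x))"
      using g by simp
    show "eventually (\<lambda>y. AE x in lborel. norm (indicator {-y..y} x *\<^sub>R g x) \<le> norm (g x)) at_top"
      by (auto simp: indicator_def)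
    show "AE x in lborel. ((\<lambda>y. indicator {-y..y} x *\<^sub>R g x) \<longlongrightarrow> g x) at_top"
    proof (rule AE_I2)
      fix x :: real
      have "eventually (\<lambda>y. indicator {-y..y} x *\<^sub>R g x = g x) at_top"
        using eventually_ge_at_top[of "\<bar>x\<bar>"] by eventually_elim (auto simp: indicator_def)
      then show "((\<lambda>y. indicator {-y..y} x *\<^sub>R g x) \<longlongrightarrow> g x) at_top"
        by (rule tendsto_eventually)
    qed
  qed (use g in auto)
  moreover have "eventually (\<lambda>y. (\<integral>x. indicator {-y..y} x *\<^sub>R g x \<partial>lborel) = f y - f (- y)) at_top"
    using eventually_ge_at_top[of 0] by eventually_elim (rule eq)
  ultimately have "((\<lambda>y. f y - f (- y)) \<longlongrightarrow> integral\<^sup>L lborel g) at_top"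
    by (rule Lim_transform_eventually)
  \<comment> \<open>Treating the difference as a single integrable function avoids separate limits
    of \<open>f\<close> at the two ends.\<close>
  moreover have "integrable lborel (\<lambda>y. f y - f (- y))"
    using f lborel_integrable_real_affine[OF f, of "-1" 0] by simp
  ultimately show ?thesis
    using tendsto_at_top_integrable_imp_zero by blast
qed

section \<open>A continuously differentiable threshold function\<close>

text \<open>For \<open>|t| > e\<close> the value is \<open>t - 2 * e * sgn t + e^2 / t\<close>, with
  slope \<open>1 - e^2 / t^2\<close>. Value and slope both tend to 0 as \<open>|t|\<close> decreases
  to \<open>e > 0\<close>, so the pieces fit together smoothly.\<close>

definition C1_threshold :: "real \<Rightarrow> real \<Rightarrow> real" where
  "C1_threshold e t = (if \<bar>t\<bar> \<le> e then 0 else sgn t * (\<bar>t\<bar> - e)\<^sup>2 / \<bar>t\<bar>)"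

text \<open>The maximum merges the flat and the outer branch into one formula, from which continuity
  and the bound by 1 are read off without cases.\<close>

definition C1_threshold_deriv :: "real \<Rightarrow> real \<Rightarrow> real" where
  "C1_threshold_deriv e t = 1 - e\<^sup>2 / (max e \<bar>t\<bar>)\<^sup>2"

text \<open>The difference quotient is at most \<open>C * |y - x|\<close>. This treats the gluing
  points of \<open>C1_threshold\<close> together with the flat part.\<close>

lemma DERIV_zero_if_quadratic_bound:
  fixes f :: "real \<Rightarrow> real"
  assumes "\<And>y. \<bar>f y - f x\<bar> \<le> C * (y - x)\<^sup>2"
  shows "(f has_real_derivative 0) (at x)"
  unfolding has_field_derivative_iff
proof (rule Lim_null_comparison)
  show "eventually (\<lambda>y. norm ((f y - f x) / (y - x)) \<le> C * \<bar>y - x\<bar>) (at x)"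
    unfolding eventually_at_filter
  proof (intro always_eventually allI impI)
    fix y assume "y \<noteq> x"
    then have "\<bar>y - x\<bar> > 0" "(y - x)\<^sup>2 = \<bar>y - x\<bar> * \<bar>y - x\<bar>"
      by (auto simp: power2_eq_square)
    with assms[of y] show "norm ((f y - f x) / (y - x)) \<le> C * \<bar>y - x\<bar>"
      by (simp add: divide_le_eq mult.assoc)
  qed
  have "((\<lambda>y. C * \<bar>y - x\<bar>) \<longlongrightarrow> C * \<bar>x - x\<bar>) (at x)"
    by (intro tendsto_intros)
  then show "((\<lambda>y. C * \<bar>y - x\<bar>) \<longlongrightarrow> 0) (at x)"
    by simp
qed

lemma DERIV_C1_threshold:
  assumes "e > 0"
  shows "(C1_threshold e has_real_derivative C1_threshold_deriv e t) (at t)"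
proof -
  consider "\<bar>t\<bar> \<le> e" | "t > e" | "t < - e"
    by linarith
  then show ?thesis
  proof cases
    case 1
    have "\<bar>C1_threshold e y - C1_threshold e t\<bar> \<le> 1 / e * (y - t)\<^sup>2" for y
    proof (cases "\<bar>y\<bar> \<le> e")
      case True
      then show ?thesis
        using 1 assms by (simp add: C1_threshold_def)
    next
      case False
      \<comment> \<open>Here \<open>|t| \<le> e < |y|\<close>, so the excess of \<open>|y|\<close>
        over \<open>e\<close> is at most \<open>|y - t|\<close>; the denominator
        \<open>|y| > e\<close> gives the constant \<open>1 / e\<close>.\<close>
      have "\<bar>\<bar>y\<bar> - e\<bar> \<le> \<bar>y - t\<bar>"
        using False 1 by linarith
      then have "(\<bar>y\<bar> - e)\<^sup>2 \<le> (y - t)\<^sup>2"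
        by (simp only: abs_le_square_iff)
      then have "(\<bar>y\<bar> - e)\<^sup>2 / \<bar>y\<bar> \<le> (y - t)\<^sup>2 / e"
        using False assms by (intro frac_le) auto
      then show ?thesis
        using False 1 assms by (simp add: C1_threshold_def abs_mult abs_sgn_eq)
    qed
    then have "(C1_threshold e has_real_derivative 0) (at t)"
      by (rule DERIV_zero_if_quadratic_bound)
    moreover have "max e \<bar>t\<bar> = e"
      using 1 by simp
    ultimately show ?thesis
      using assms by (simp add: C1_threshold_deriv_def)
  next
    case 2
    have "((\<lambda>y. (y - e)\<^sup>2 / y) has_real_derivative C1_threshold_deriv e t) (at t)"
      using 2 assms
      by (auto intro!: derivative_eq_intros simp: C1_threshold_deriv_def field_simps power2_eq_square)
    then show ?thesis
      by (rule has_field_derivative_transform_within_open[where S = "{e<..}"])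
         (use 2 assms in \<open>auto simp: C1_threshold_def\<close>)
  next
    case 3
    \<comment> \<open>For \<open>y < - e\<close> the sign factor and \<open>|y| = - y\<close>
      combine, leaving \<open>(y + e)^2 / y\<close>.\<close>
    have "((\<lambda>y. (y + e)\<^sup>2 / y) has_real_derivative C1_threshold_deriv e t) (at t)"
      using 3 assms
      by (auto intro!: derivative_eq_intros simp: C1_threshold_deriv_def field_simps power2_eq_square)
    then show ?thesis
      by (rule has_field_derivative_transform_within_open[where S = "{..<-e}"])
         (use 3 assms in \<open>auto simp: C1_threshold_def power2_eq_square field_simps\<close>)
  qed
qed

lemma abs_C1_threshold_le: "e \<ge> 0 \<Longrightarrow> \<bar>C1_threshold e t\<bar> \<le> \<bar>t\<bar>"
proof (cases "\<bar>t\<bar> \<le> e")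
  case False
  assume "e \<ge> 0"
  have "(\<bar>t\<bar> - e)\<^sup>2 \<le> \<bar>t\<bar>\<^sup>2"
    using False \<open>e \<ge> 0\<close> by (intro power_mono) auto
  then show ?thesis
    using False \<open>e \<ge> 0\<close>
    by (simp add: C1_threshold_def abs_mult abs_sgn_eq divide_le_eq power2_eq_square)
qed (simp add: C1_threshold_def)

lemma C1_threshold_deriv_eq_0: "e > 0 \<Longrightarrow> \<bar>t\<bar> \<le> e \<Longrightarrow> C1_threshold_deriv e t = 0"
  by (simp add: C1_threshold_deriv_def max_def)

lemma abs_C1_threshold_deriv_le:
  assumes "e > 0"
  shows "\<bar>C1_threshold_deriv e t\<bar> \<le> 1"
proof -
  have "e\<^sup>2 \<le> (max e \<bar>t\<bar>)\<^sup>2"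
    using assms by (intro power_mono) auto
  then have "e\<^sup>2 / (max e \<bar>t\<bar>)\<^sup>2 \<le> 1"
    by (intro divide_le_eq_1[THEN iffD2]) (use assms in auto)
  moreover have "0 \<le> e\<^sup>2 / (max e \<bar>t\<bar>)\<^sup>2"
    by simp
  ultimately show ?thesis
    unfolding C1_threshold_deriv_def by linarith
qed

lemma continuous_on_C1_threshold_deriv:
  "e > 0 \<Longrightarrow> continuous_on UNIV (C1_threshold_deriv e)"
  unfolding C1_threshold_deriv_def by (intro continuous_intros) (auto simp: max_def)

lemma tendsto_C1_threshold_deriv:
  assumes "t \<noteq> 0"
  shows "(\<lambda>n. C1_threshold_deriv (inverse (real (Suc n))) t) \<longlonglongrightarrow> 1"
proof -
  have "(\<lambda>n. 1 - (inverse (real (Suc n)))\<^sup>2 / (max (inverse (real (Suc n))) \<bar>t\<bar>)\<^sup>2)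
          \<longlonglongrightarrow> 1 - 0\<^sup>2 / (max 0 \<bar>t\<bar>)\<^sup>2"
    using assms by (intro tendsto_intros LIMSEQ_inverse_real_of_nat) auto
  then show ?thesis
    by (simp add: C1_threshold_deriv_def)
qed

section \<open>Integrals of derivatives that may fail to exist at zeros\<close>

text \<open>The second alternative in \<open>der\<close> admits zeros at which \<open>f\<close> has
  no derivative. Composing with \<open>C1_threshold\<close> makes \<open>f\<close> flat around every
  zero, and dominated convergence with bound \<open>|g|\<close> removes the threshold again.\<close>

lemma integral_deriv_off_zeros_eq_zero:
  fixes f g :: "real \<Rightarrow> real"
  assumes cont: "continuous_on UNIV f"
    and f: "integrable lborel f" and g: "integrable lborel g"
    and der: "\<And>x. (f has_real_derivative g x) (at x) \<or> f x = 0 \<and> g x = 0"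
  shows "integral\<^sup>L lborel g = 0"
proof -
  define e where "e n = inverse (real (Suc n))" for n
  have e: "e n > 0" for n
    by (simp add: e_def)
  define k where "k n x = C1_threshold_deriv (e n) (f x) * g x" for n x
  have [measurable]: "f \<in> borel_measurable borel" "g \<in> borel_measurable borel"
    using f g by (auto dest: borel_measurable_integrable)
  have dm[measurable]: "C1_threshold_deriv (e n) \<in> borel_measurable borel" for n
    by (rule borel_measurable_continuous_onI[OF continuous_on_C1_threshold_deriv[OF e]])
  have km[measurable]: "k n \<in> borel_measurable borel" for n
    unfolding k_def by measurable
  have k_le: "\<bar>k n x\<bar> \<le> \<bar>g x\<bar>" for n x
    using mult_right_mono[OF abs_C1_threshold_deriv_le[OF e], of "\<bar>g x\<bar>" n "f x"]
    by (simp add: k_def abs_mult)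
  have int0: "integral\<^sup>L lborel (k n) = 0" for n
  proof (rule integral_deriv_eq_zero)
    show k: "((\<lambda>x. C1_threshold (e n) (f x)) has_real_derivative k n x) (at x)" for x
    proof (cases "f x = 0")
      case False
      with der[of x] have "(f has_real_derivative g x) (at x)"
        by simp
      from DERIV_chain2[OF DERIV_C1_threshold[OF e] this] show ?thesis
        by (simp add: k_def)
    next
      case True
      \<comment> \<open>By continuity \<open>|f|\<close> stays below \<open>e n\<close> near a zero,
        so the composition is locally constant there whether or not \<open>f\<close> is
        differentiable.\<close>
      have "open {y. \<bar>f y\<bar> < e n}"
        using cont by (intro open_Collect_less continuous_intros)
      then have "((\<lambda>x. C1_threshold (e n) (f x)) has_real_derivative 0) (at x)"
        by (intro has_field_derivative_transform_within_open[OF DERIV_const[where k = 0]])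
           (use True e[of n] in \<open>auto simp: C1_threshold_def\<close>)
      then show ?thesis
        using True e[of n] by (simp add: k_def C1_threshold_deriv_eq_0)
    qed
    have "continuous_on UNIV (\<lambda>x. C1_threshold (e n) (f x))"
      using k DERIV_isCont continuous_at_imp_continuous_on by blast
    then have "(\<lambda>x. C1_threshold (e n) (f x)) \<in> borel_measurable lborel"
      using borel_measurable_continuous_onI by simp
    then show "integrable lborel (\<lambda>x. C1_threshold (e n) (f x))"
      by (rule Bochner_Integration.integrable_bound[OF f])
         (use e[of n] in \<open>auto simp: abs_C1_threshold_le\<close>)
    show "integrable lborel (k n)"
      by (rule Bochner_Integration.integrable_bound[OF g]) (auto simp: k_le)
  qed
  \<comment> \<open>At a zero of \<open>f\<close> every \<open>k n x\<close> is 0, so convergence to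
    \<open>g x\<close> could fail only where \<open>g x\<close> is nonzero. By \<open>der\<close>
    this is then a genuine derivative, and such points form a null set.\<close>
  have "AE x in lborel. \<not> (f x = 0 \<and> (f has_real_derivative g x) (at x) \<and> g x \<noteq> 0)"
    using countable_imp_null_set_lborel[OF countable_zeros_nonzero_deriv[of f g]]
    by (auto dest!: AE_not_in)
  then have "AE x in lborel. (\<lambda>n. k n x) \<longlonglongrightarrow> g x"
  proof eventually_elim
    case (elim x)
    show ?case
    proof (cases "f x = 0")
      case True
      then have "g x = 0"
        using elim der[of x] by blast
      then show ?thesis
        by (simp add: k_def)
    next
      case False
      have "(\<lambda>n. k n x) \<longlonglongrightarrow> 1 * g x"
        unfolding k_def e_def by (intro tendsto_intros tendsto_C1_threshold_deriv False)
      then show ?thesis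
        by simp
    qed
  qed
  then have "(\<lambda>n. integral\<^sup>L lborel (k n)) \<longlonglongrightarrow> integral\<^sup>L lborel g"
    by (intro integral_dominated_convergence[where w = "\<lambda>x. \<bar>g x\<bar>"]) (use g in \<open>auto simp: k_le\<close>)
  then show ?thesis
    by (simp add: int0 LIMSEQ_const_iff)
qed

section \<open>Reduction from the plane to lines by Fubini\<close>

text \<open>Fubini makes the slices of \<open>F\<close> and \<open>g\<close> integrable for almost
  every \<open>y\<close> only, which suffices because the outer integral ignores null sets.\<close>

lemma integral_partial_fst_eq_zero:
  fixes F g :: "real \<times> real \<Rightarrow> real"
  assumes cont: "continuous_on UNIV F"
    and F: "integrable lborel F" and g: "integrable lborel g"
    and der: "\<And>x y. ((\<lambda>t. F (t, y)) has_real_derivative g (x, y)) (at x) \<or> F (x, y) = 0 \<and> g (x, y) = 0"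
  shows "integral\<^sup>L lborel g = 0"
proof -
  have F': "integrable (lborel \<Otimes>\<^sub>M lborel) (\<lambda>(x, y). F (x, y))"
    and g': "integrable (lborel \<Otimes>\<^sub>M lborel) (\<lambda>(x, y). g (x, y))"
    using F g by (simp_all add: lborel_prod)
  have "AE y in lborel. (\<integral>x. g (x, y) \<partial>lborel) = 0"
    using lborel_pair.AE_integrable_snd[OF F'] lborel_pair.AE_integrable_snd[OF g']
  proof eventually_elim
    case (elim y)
    have "continuous_on UNIV (\<lambda>x. F (x, y))"
      by (rule continuous_on_compose2[OF cont]) (auto intro!: continuous_intros)
    then show ?case
      using elim by (rule integral_deriv_off_zeros_eq_zero) (rule der)
  qed
  then have "(\<integral>y. (\<integral>x. g (x, y) \<partial>lborel) \<partial>lborel) = 0"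
    by (rule integral_eq_zero_AE)
  then show ?thesis
    using lborel_pair.integral_snd[OF g'] by (simp add: lborel_prod)
qed

lemma integral_partial_snd_eq_zero:
  fixes F g :: "real \<times> real \<Rightarrow> real"
  assumes cont: "continuous_on UNIV F"
    and F: "integrable lborel F" and g: "integrable lborel g"
    and der: "\<And>x y. ((\<lambda>t. F (x, t)) has_real_derivative g (x, y)) (at y) \<or> F (x, y) = 0 \<and> g (x, y) = 0"
  shows "integral\<^sup>L lborel g = 0"
proof -
  have F': "integrable (lborel \<Otimes>\<^sub>M lborel) (\<lambda>(x, y). F (x, y))"
    and g': "integrable (lborel \<Otimes>\<^sub>M lborel) (\<lambda>(x, y). g (x, y))"
    using F g by (simp_all add: lborel_prod)
  have "AE x in lborel. (\<integral>y. g (x, y) \<partial>lborel) = 0"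
    using lborel_pair.AE_integrable_fst[OF F'] lborel_pair.AE_integrable_fst[OF g']
  proof eventually_elim
    case (elim x)
    have "continuous_on UNIV (\<lambda>y. F (x, y))"
      by (rule continuous_on_compose2[OF cont]) (auto intro!: continuous_intros)
    then show ?case
      using elim by (rule integral_deriv_off_zeros_eq_zero) (rule der)
  qed
  then have "(\<integral>x. (\<integral>y. g (x, y) \<partial>lborel) \<partial>lborel) = 0"
    by (rule integral_eq_zero_AE)
  then show ?thesis
    using lborel_pair.integral_fst[OF g'] by (simp add: lborel_prod)
qed

section \<open>Continuity and integrability of the products\<close>

lemma continuous_on_poly_xy: "continuous_on A (poly_xy P)"
proof -
  have eq: "poly_xy P = (\<lambda>z. \<Sum>i\<le>degree P. poly (coeff P i) (fst z) * snd z ^ i)"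
    by (rule ext) (simp add: poly_xy_def poly_altdef[of P] poly_sum poly_power)
  show ?thesis
    unfolding eq by (intro continuous_intros)
qed

text \<open>The closed sets \<open>closure \<Omega>\<close> and \<open>- \<Omega>\<close> cover the
  space and overlap in the frontier, where both pieces are 0.\<close>

lemma continuous_on_extend_by_zero:
  fixes f :: "'a::topological_space \<Rightarrow> real"
  assumes "open \<Omega>" "continuous_on (closure \<Omega>) f" "\<forall>z\<in>frontier \<Omega>. f z = 0"
  shows "continuous_on UNIV (\<lambda>z. indicator \<Omega> z * f z)"
proof -
  have "continuous_on (closure \<Omega> \<union> - \<Omega>) (\<lambda>z. if z \<in> \<Omega> then f z else 0)"
  proof (rule continuous_on_cases)
    show "\<forall>x. x \<in> closure \<Omega> \<and> x \<notin> \<Omega> \<or> x \<in> - \<Omega> \<and> x \<in> \<Omega> \<longrightarrow> f x = 0"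
      using assms(1,3) by (auto simp: frontier_def interior_open)
  qed (use assms in auto)
  moreover have "closure \<Omega> \<union> - \<Omega> = UNIV"
    using closure_subset by blast
  moreover have "(\<lambda>z. if z \<in> \<Omega> then f z else 0) = (\<lambda>z. indicator \<Omega> z * f z)"
    by (auto simp: indicator_def)
  ultimately show ?thesis
    by (simp only:)
qed

lemma W_system_mult:
  "w z \<ge> 0 \<Longrightarrow> W_system w p a z * W_system w p b z = w z * (poly_xy (p a) z * poly_xy (p b) z)"
  by (simp add: W_system_def algebra_simps)

text \<open>The squares are integrable by normalization, and \<open>|s * t| \<le> s^2 + t^2\<close>
  transfers this to mixed products. The hypothesis \<open>meas\<close> is later supplied by
  continuity.\<close>

lemma orthonormal_polynomial_system_integrable:
  assumes w: "weight_function \<Omega> w" and p: "orthonormal_polynomial_system \<Omega> w p"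
    and a: "a \<in> graded_indices" and b: "b \<in> graded_indices"
    and meas: "(\<lambda>z. indicator \<Omega> z * (w z * (poly_xy (p a) z * poly_xy (p b) z))) \<in> borel_measurable borel"
  shows "integrable lborel (\<lambda>z. indicator \<Omega> z * (w z * (poly_xy (p a) z * poly_xy (p b) z)))"
proof -
  have sq: "integrable lborel (\<lambda>z. indicator \<Omega> z * (w z * (poly_xy (p c) z)\<^sup>2))"
    if "c \<in> graded_indices" for c
  proof (rule ccontr)
    \<comment> \<open>A non-integrable function has Bochner integral 0 by default, contradicting the
      value 1.\<close>
    assume "\<not> ?thesis"
    moreover have "(LINT z:\<Omega>|lborel. poly_xy (p c) z * poly_xy (p c) z * w z) = 1"
      using p that by (auto simp: orthonormal_polynomial_system_def)
    then have "(\<integral>z. indicator \<Omega> z * (w z * (poly_xy (p c) z)\<^sup>2) \<partial>lborel) = 1"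
      by (simp add: set_lebesgue_integral_def power2_eq_square mult_ac)
    ultimately show False
      using not_integrable_integral_eq by fastforce
  qed
  show ?thesis
  proof (rule Bochner_Integration.integrable_bound[OF Bochner_Integration.integrable_add[OF sq[OF a] sq[OF b]]])
    show "AE z in lborel. norm (indicator \<Omega> z * (w z * (poly_xy (p a) z * poly_xy (p b) z)))
        \<le> norm (indicator \<Omega> z * (w z * (poly_xy (p a) z)\<^sup>2) + indicator \<Omega> z * (w z * (poly_xy (p b) z)\<^sup>2))"
    proof (rule AE_I2)
      fix z
      have *: "\<bar>s * t\<bar> \<le> s\<^sup>2 + t\<^sup>2" for s t :: real
      proof -
        have "2 * (\<bar>s\<bar> * \<bar>t\<bar>) \<le> s\<^sup>2 + t\<^sup>2"
          using sum_squares_bound[of "\<bar>s\<bar>" "\<bar>t\<bar>"] by (simp add: mult.assoc)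
        moreover have "0 \<le> \<bar>s\<bar> * \<bar>t\<bar>"
          by simp
        ultimately show ?thesis
          unfolding abs_mult by linarith
      qed
      show "norm (indicator \<Omega> z * (w z * (poly_xy (p a) z * poly_xy (p b) z)))
        \<le> norm (indicator \<Omega> z * (w z * (poly_xy (p a) z)\<^sup>2) + indicator \<Omega> z * (w z * (poly_xy (p b) z)\<^sup>2))"
      proof (cases "z \<in> \<Omega>")
        case True
        then have "w z \<ge> 0"
          using w by (auto simp: weight_function_def)
        then have "\<bar>w z * (poly_xy (p a) z * poly_xy (p b) z)\<bar>
            \<le> w z * ((poly_xy (p a) z)\<^sup>2 + (poly_xy (p b) z)\<^sup>2)"
          using mult_left_mono[OF *] by (simp add: abs_mult)
        then show ?thesis
          using True \<open>w z \<ge> 0\<close> by (simp add: distrib_left)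
      qed simp
    qed
  qed (use meas in simp)
qed

section \<open>Skew-symmetry of the differentiation matrices\<close>

theorem theorem2p1:
  fixes \<Omega> :: "(real \<times> real) set"
    and w :: "real \<times> real \<Rightarrow> real"
    and p :: "nat \<times> nat \<Rightarrow> real poly poly"
  assumes "domain_with_jordan_boundary \<Omega>"
    and "simply_connected \<Omega>"
    and "weight_function \<Omega> w"
    and "continuous_on (closure \<Omega>) w"
    and "\<forall>z\<in>frontier \<Omega>. w z = 0"
    and "orthonormal_polynomial_system \<Omega> w p"
    and "\<forall>a\<in>graded_indices. \<forall>z\<in>\<Omega>. w z > 0 \<longrightarrow> has_partials_at (W_system w p a) z"
    and "diff_matrices_exist \<Omega> (W_system w p)"
  shows "skew_symmetric_on graded_indices (diff_matrix_x \<Omega> (W_system w p)) \<and>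
         skew_symmetric_on graded_indices (diff_matrix_y \<Omega> (W_system w p))"
proof -
  have "open \<Omega>"
    using assms(1) by (simp add: domain_with_jordan_boundary_def)
  have w_nonneg: "w z \<ge> 0" if "z \<in> \<Omega>" for z
    using assms(3) that by (simp add: weight_function_def)
  have "diff_matrix_x \<Omega> (W_system w p) a b = - diff_matrix_x \<Omega> (W_system w p) b a \<and>
        diff_matrix_y \<Omega> (W_system w p) a b = - diff_matrix_y \<Omega> (W_system w p) b a"
    if ab: "a \<in> graded_indices" "b \<in> graded_indices" for a b
  proof -
    let ?\<phi> = "W_system w p"
    define F where "F z = indicator \<Omega> z * (w z * (poly_xy (p a) z * poly_xy (p b) z))" for z
    have F_eq: "F z = ?\<phi> a z * ?\<phi> b z" if "z \<in> \<Omega>" for z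
      using that by (simp add: F_def W_system_mult w_nonneg)
    have F_cont: "continuous_on UNIV F"
      unfolding F_def
      using assms(4,5) by (intro continuous_on_extend_by_zero continuous_intros continuous_on_poly_xy \<open>open \<Omega>\<close>) auto
    have F_int: "integrable lborel F"
      using borel_measurable_continuous_onI[OF F_cont] unfolding F_def
      by (rule orthonormal_polynomial_system_integrable[OF assms(3,6) ab])
    have W0: "?\<phi> c z = 0" if "w z = 0" for c z
      using that by (simp add: W_system_def)
    have F0: "F z = 0" if "z \<notin> \<Omega> \<or> w z = 0" for z
      using that by (auto simp: F_def)
    have Wx: "((\<lambda>t. ?\<phi> c (t, y)) has_real_derivative partial_x (?\<phi> c) (x, y)) (at x)"
      and Wy: "((\<lambda>t. ?\<phi> c (x, t)) has_real_derivative partial_y (?\<phi> c) (x, y)) (at y)"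
      if "c \<in> graded_indices" "(x, y) \<in> \<Omega>" "w (x, y) > 0" for c x y
    proof -
      have "has_partials_at (?\<phi> c) (x, y)"
        using assms(7) that by blast
      then show "((\<lambda>t. ?\<phi> c (t, y)) has_real_derivative partial_x (?\<phi> c) (x, y)) (at x)"
        and "((\<lambda>t. ?\<phi> c (x, t)) has_real_derivative partial_y (?\<phi> c) (x, y)) (at y)"
        by (simp_all add: has_partials_at_def partial_x_def partial_y_def
            DERIV_deriv_iff_field_differentiable)
    qed
    have w_pos: "w z > 0" if "z \<in> \<Omega>" "w z \<noteq> 0" for z
      using w_nonneg[OF that(1)] that(2) by simp
    have x_int: "integrable lborel (\<lambda>z. indicator \<Omega> z * (partial_x (?\<phi> d) z * ?\<phi> c z))"
      and y_int: "integrable lborel (\<lambda>z. indicator \<Omega> z * (partial_y (?\<phi> d) z * ?\<phi> c z))"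
      if "c \<in> graded_indices" "d \<in> graded_indices" for c d
      using assms(8) that by (simp_all add: diff_matrices_exist_def set_integrable_def)
    \<comment> \<open>The product rule makes this the derivative of \<open>F\<close> along
      \<open>x\<close> wherever \<open>w > 0\<close> in \<open>\<Omega>\<close>; its integral is the
      sum of two transposed matrix entries.\<close>
    define gx where "gx z = indicator \<Omega> z * (partial_x (?\<phi> b) z * ?\<phi> a z) +
      indicator \<Omega> z * (partial_x (?\<phi> a) z * ?\<phi> b z)" for z
    define gy where "gy z = indicator \<Omega> z * (partial_y (?\<phi> b) z * ?\<phi> a z) +
      indicator \<Omega> z * (partial_y (?\<phi> a) z * ?\<phi> b z)" for z
    have gx_int: "integrable lborel gx"
      unfolding gx_def using x_int ab by simp
    have gy_int: "integrable lborel gy"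
      unfolding gy_def using y_int ab by simp
    have "integral\<^sup>L lborel gx = 0"
    proof (rule integral_partial_fst_eq_zero[OF F_cont F_int gx_int])
      fix x y
      show "((\<lambda>t. F (t, y)) has_real_derivative gx (x, y)) (at x) \<or> F (x, y) = 0 \<and> gx (x, y) = 0"
      \<comment> \<open>In the other case \<open>F\<close> and \<open>gx\<close> both vanish:
        outside \<open>\<Omega>\<close> through the indicator, and at zeros of \<open>w\<close>
        because the undifferentiated factors are 0, whatever value \<open>partial_x\<close>
        takes.\<close>
      proof (cases "(x, y) \<in> \<Omega> \<and> w (x, y) \<noteq> 0")
        case True
        have "((\<lambda>t. ?\<phi> a (t, y) * ?\<phi> b (t, y)) has_real_derivative gx (x, y)) (at x)"
          using True ab by (auto intro!: derivative_eq_intros Wx w_pos simp: gx_def)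
        \<comment> \<open>The slice of \<open>\<Omega>\<close> is an open neighbourhood of
          \<open>x\<close> on which \<open>F\<close> coincides with the product.\<close>
        moreover have "open ((\<lambda>t. (t, y)) -` \<Omega>)"
          by (intro open_vimage \<open>open \<Omega>\<close> continuous_intros)
        ultimately have "((\<lambda>t. F (t, y)) has_real_derivative gx (x, y)) (at x)"
          by (rule has_field_derivative_transform_within_open)
             (use True F_eq in auto)
        then show ?thesis ..
      qed (auto simp: F0 W0 gx_def)
    qed
    moreover have "integral\<^sup>L lborel gy = 0"
    proof (rule integral_partial_snd_eq_zero[OF F_cont F_int gy_int])
      fix x y
      show "((\<lambda>t. F (x, t)) has_real_derivative gy (x, y)) (at y) \<or> F (x, y) = 0 \<and> gy (x, y) = 0"
      proof (cases "(x, y) \<in> \<Omega> \<and> w (x, y) \<noteq> 0")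
        case True
        have "((\<lambda>t. ?\<phi> a (x, t) * ?\<phi> b (x, t)) has_real_derivative gy (x, y)) (at y)"
          using True ab by (auto intro!: derivative_eq_intros Wy w_pos simp: gy_def)
        moreover have "open ((\<lambda>t. (x, t)) -` \<Omega>)"
          by (intro open_vimage \<open>open \<Omega>\<close> continuous_intros)
        ultimately have "((\<lambda>t. F (x, t)) has_real_derivative gy (x, y)) (at y)"
          by (rule has_field_derivative_transform_within_open)
             (use True F_eq in auto)
        then show ?thesis ..
      qed (auto simp: F0 W0 gy_def)
    qed
    \<comment> \<open>Splitting the integral is legitimate because each summand is integrable by
      \<open>x_int\<close>.\<close>
    moreover have "integral\<^sup>L lborel gx = diff_matrix_x \<Omega> ?\<phi> a b + diff_matrix_x \<Omega> ?\<phi> b a"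
      unfolding gx_def diff_matrix_x_def set_lebesgue_integral_def using x_int ab by simp
    moreover have "integral\<^sup>L lborel gy = diff_matrix_y \<Omega> ?\<phi> a b + diff_matrix_y \<Omega> ?\<phi> b a"
      unfolding gy_def diff_matrix_y_def set_lebesgue_integral_def using y_int ab by simp
    ultimately show ?thesis
      by simp
  qed
  then show ?thesis
    unfolding skew_symmetric_on_def by blast
qed

end
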